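(* Let $p\ge 2$, $A\in\mathbb{R}^{m\times n}$, $b\in\mathbb{R}^m$, $C\in\mathbb{R}^{p\times n}$, and consider the multi-objective linear optimization problem (MOLP) $\min_{x\in\mathcal{X}} Cx$ with feasible set $\mathcal{X}=\{x\in\mathbb{R}^n : Ax\leqq b,\ x\geqq 0\}$ and outcome set $\mathcal{Y}=\{Cx : x\in\mathcal{X}\}$. Assume that its set of non-dominated points $\mathcal{Y}_N$ is non-empty. Then $$\mathcal{Y}_{S\partial}=\mathcal{Y}_{SNF}=\mathcal{Y}_{S\lambda}.$$
   Context: For $y^1,y^2\in\mathbb{R}^p$: $y^1\leqq y^2$ means $y^1_i\le y^2_i$ for all $i$; $y^1\le y^2$ means $y^1\leqq y^2$ and $y^1\neq y^2$; $y^1<y^2$ means $y^1_i<y^2_i$ for all $i$. Let $\mathbb{R}^p_{\geqq}=\{y\in\mathbb{R}^p : y\geqq 0\}$ and $\mathbb{R}^p_{>}=\{y\in\mathbb{R}^p: y>0\}$. Sums and differences of sets are Minkowski sums and differences; $\partial$ denotes the boundary. A feasible solution $x^*\in\mathcal{X}$ is efficient if there is no $x\in\mathcal{X}$ with $Cx\le Cx^*$ (that is, $Cx\leqq Cx^*$ and $Cx\ne Cx^*$); its image $Cx^*$ is then called non-dominated. $\mathcal{Y}_N\subseteq\mathcal{Y}$ is the set of non-dominated points. The upper image is $\mathcal{Y}^{\geqq}=\operatorname{conv}(\mathcal{Y}_N+\mathbb{R}^p_{\geqq})$. Let $\Lambda_p=\{\lambda\in\mathbb{R}^p_{>} : \sum_{i=1}^p\lambda_i=1\}$,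 and let $P_\lambda$ denote the weighted-sum problem $\min_{x\in\mathcal{X}}\lambda^\top Cx$. The three sets are: - $\mathcal{Y}_{S\partial}=\mathcal{Y}_N\cap\partial\mathcal{Y}^{\geqq}$; - $\mathcal{Y}_{SNF}$ is the set of all $y\in\mathcal{Y}_N$ that lie on the non-dominated frontier $\{y\in\operatorname{conv}(\mathcal{Y}_N) : \operatorname{conv}(\mathcal{Y}_N)\cap(y-\mathbb{R}^p_{\geqq})=\{y\}\}$; - $\mathcal{Y}_{S\lambda}$ is the set of all images $Cx$ of efficient solutions $x\in\mathcal{X}$ for which there exists $\lambda\in\Lambda_p$ such that $x$ is an optimal solution of $P_\lambda$. *)

theory Defs
  imports "HOL-Analysis.Analysis"
begin

text \<open>
  On \<open>real ^ 'k\<close> the library order \<open>x \<le> y\<close> is the componentwise order, written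
  \<open>x \<leqq> y\<close> in the paper, and the library's \<open>x < y\<close> means \<open>x \<le> y \<and> x \<noteq> y\<close>, written \<open>x \<le> y\<close> in the
  paper; it is not the componentwise strict order.
\<close>

definition nonneg_orthant :: "(real ^ 'p) set" where
  "nonneg_orthant = {y. 0 \<le> y}"

definition pos_orthant :: "(real ^ 'p) set" where
  "pos_orthant = {y. \<forall>i. 0 < y $ i}"

definition weights :: "(real ^ 'p) set" where
  "weights = {w \<in> pos_orthant. (\<Sum>i\<in>UNIV. w $ i) = 1}"

definition feasible_set :: "real ^ 'n ^ 'm \<Rightarrow> real ^ 'm \<Rightarrow> (real ^ 'n) set" where
  "feasible_set A b = {x. A *v x \<le> b \<and> 0 \<le> x}"

definition outcome_set :: "real ^ 'n ^ 'm \<Rightarrow> real ^ 'm \<Rightarrow> real ^ 'n ^ 'p \<Rightarrow> (real ^ 'p) set" where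
  "outcome_set A b C = {C *v x | x. x \<in> feasible_set A b}"

definition efficient ::
    "real ^ 'n ^ 'm \<Rightarrow> real ^ 'm \<Rightarrow> real ^ 'n ^ 'p \<Rightarrow> real ^ 'n \<Rightarrow> bool" where
  "efficient A b C x \<longleftrightarrow>
     x \<in> feasible_set A b \<and>
     \<not> (\<exists>x'\<in>feasible_set A b. C *v x' \<le> C *v x \<and> C *v x' \<noteq> C *v x)"

definition nondominated_set ::
    "real ^ 'n ^ 'm \<Rightarrow> real ^ 'm \<Rightarrow> real ^ 'n ^ 'p \<Rightarrow> (real ^ 'p) set" where
  "nondominated_set A b C = {C *v x | x. efficient A b C x}"

text \<open>The sum of sets below is the Minkowski sum.\<close>

definition upper_image ::
    "real ^ 'n ^ 'm \<Rightarrow> real ^ 'm \<Rightarrow> real ^ 'n ^ 'p \<Rightarrow> (real ^ 'p) set" where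
  "upper_image A b C = convex hull (nondominated_set A b C + nonneg_orthant)"

text \<open>
  The Minkowski difference of a point \<open>y\<close> and the orthant is written as an image, since \<open>-\<close> on sets
  is set difference.
\<close>

definition nondominated_frontier ::
    "real ^ 'n ^ 'm \<Rightarrow> real ^ 'm \<Rightarrow> real ^ 'n ^ 'p \<Rightarrow> (real ^ 'p) set" where
  "nondominated_frontier A b C =
     {y \<in> convex hull (nondominated_set A b C).
        convex hull (nondominated_set A b C) \<inter> (\<lambda>r. y - r) ` nonneg_orthant = {y}}"

definition weighted_sum_optimal ::
    "real ^ 'n ^ 'm \<Rightarrow> real ^ 'm \<Rightarrow> real ^ 'n ^ 'p \<Rightarrow> real ^ 'p \<Rightarrow> real ^ 'n \<Rightarrow> bool" where
  "weighted_sum_optimal A b C w x \<longleftrightarrow>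
     is_arg_min (\<lambda>x. w \<bullet> (C *v x)) (\<lambda>x. x \<in> feasible_set A b) x"

definition supported_boundary ::
    "real ^ 'n ^ 'm \<Rightarrow> real ^ 'm \<Rightarrow> real ^ 'n ^ 'p \<Rightarrow> (real ^ 'p) set" where
  "supported_boundary A b C = nondominated_set A b C \<inter> frontier (upper_image A b C)"

definition supported_frontier ::
    "real ^ 'n ^ 'm \<Rightarrow> real ^ 'm \<Rightarrow> real ^ 'n ^ 'p \<Rightarrow> (real ^ 'p) set" where
  "supported_frontier A b C = {y \<in> nondominated_set A b C. y \<in> nondominated_frontier A b C}"

definition supported_weighted ::
    "real ^ 'n ^ 'm \<Rightarrow> real ^ 'm \<Rightarrow> real ^ 'n ^ 'p \<Rightarrow> (real ^ 'p) set" where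
  "supported_weighted A b C =
     {C *v x | x. efficient A b C x \<and> (\<exists>w\<in>weights. weighted_sum_optimal A b C w x)}"

end

theory Submission
  imports Defs
begin

text \<open>
  Each of the three sets is all of \<open>\<Y>\<^sub>N\<close>. For the boundary and the frontier this only uses that
  \<open>\<Y>\<close> is convex. For the weighted sums it is Isermann's theorem: if the feasible directions at an
  efficient \<open>x\<close> are the solutions of \<open>a\<^sub>k \<bullet> d \<le> 0\<close>, then by efficiency no hyperplane through the
  origin separates minus the sum of the rows of \<open>C\<close> from the finitely generated, hence closed, cone
  spanned by the \<open>a\<^sub>k\<close> and the rows of \<open>C\<close>. So the sum belongs to the cone, and the coefficients of
  the rows of \<open>C\<close>, increased by one, are the weights.
\<close>

section \<open>Feasible directions of a polyhedron at one of its points\<close>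

definition feasible_directions :: "'a::real_vector \<Rightarrow> 'a set \<Rightarrow> 'a set" where
  "feasible_directions x S = {d. \<exists>t>0. x + t *\<^sub>R d \<in> S}"

lemma convex_shrink_direction:
  fixes x d :: "'a::real_vector"
  assumes "convex S" "x \<in> S" "x + t *\<^sub>R d \<in> S" "0 < s" "s \<le> t"
  shows "x + s *\<^sub>R d \<in> S"
proof -
  have "(1 - s / t) *\<^sub>R x + (s / t) *\<^sub>R (x + t *\<^sub>R d) \<in> S"
    by (rule convexD[OF assms(1-3)]) (use assms in auto)
  also have "(1 - s / t) *\<^sub>R x + (s / t) *\<^sub>R (x + t *\<^sub>R d) = x + s *\<^sub>R d"
    using assms(4,5) by (simp add: algebra_simps)
  finally show ?thesis .
qed

text \<open>The two sets may admit different step lengths along the same direction; by convexity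
  both can be shortened to the smaller one.\<close>

lemma feasible_directions_Int:
  assumes "convex S" "convex T" "x \<in> S" "x \<in> T"
  shows "feasible_directions x (S \<inter> T) = feasible_directions x S \<inter> feasible_directions x T"
proof (intro equalityI subsetI)
  fix d assume "d \<in> feasible_directions x S \<inter> feasible_directions x T"
  then obtain s t where st: "s > 0" "x + s *\<^sub>R d \<in> S" "t > 0" "x + t *\<^sub>R d \<in> T"
    by (auto simp: feasible_directions_def)
  have "x + min s t *\<^sub>R d \<in> S"
    by (rule convex_shrink_direction[where t = s]) (use assms st in auto)
  moreover have "x + min s t *\<^sub>R d \<in> T"
    by (rule convex_shrink_direction[where t = t]) (use assms st in auto)
  ultimately show "d \<in> feasible_directions x (S \<inter> T)"
    using st by (auto simp: feasible_directions_def intro!: exI[of _ "min s t"])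
qed (auto simp: feasible_directions_def)

text \<open>A constraint with slack at \<open>x\<close> tolerates a short step in any direction; a
  tight one forbids exactly the directions in which its left side grows.\<close>

lemma feasible_directions_halfspace:
  fixes x a :: "'a::euclidean_space"
  assumes "a \<bullet> x \<le> c"
  shows "feasible_directions x {y. a \<bullet> y \<le> c} = (if a \<bullet> x = c then {d. a \<bullet> d \<le> 0} else UNIV)"
proof (cases "a \<bullet> x = c")
  case True
  then show ?thesis
    by (auto simp: feasible_directions_def inner_add_right mult_le_0_iff intro: exI[of _ 1])
next
  case False
  have "d \<in> feasible_directions x {y. a \<bullet> y \<le> c}" for d
  proof -
    \<comment> \<open>The step is the slack divided by more than
      \<open>\<bar>a \<bullet> d\<bar>\<close>, so it cannot use up the slack. The added 1 keeps the
      denominator positive when \<open>a \<bullet> d = 0\<close>.\<close>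
    define t where "t = (c - a \<bullet> x) / (1 + \<bar>a \<bullet> d\<bar>)"
    have "t > 0" using False assms by (simp add: t_def)
    have "t * (a \<bullet> d) \<le> t * (1 + \<bar>a \<bullet> d\<bar>)"
      using \<open>t > 0\<close> by (intro mult_left_mono) auto
    also have "\<dots> = c - a \<bullet> x" by (simp add: t_def)
    finally have "x + t *\<^sub>R d \<in> {y. a \<bullet> y \<le> c}" by (simp add: inner_add_right)
    with \<open>t > 0\<close> show ?thesis unfolding feasible_directions_def by blast
  qed
  with False show ?thesis by auto
qed

text \<open>Only constraints tight at \<open>x\<close> survive, and \<open>N\<close> collects their
  normals while the half-spaces are intersected one at a time.\<close>

lemma feasible_directions_polyhedron:
  fixes x :: "'a::euclidean_space"
  assumes "polyhedron S" "x \<in> S"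
  shows "\<exists>N. finite N \<and> feasible_directions x S = {d. \<forall>a\<in>N. a \<bullet> d \<le> 0}"
proof -
  obtain F where F: "finite F" "S = \<Inter>F" "\<And>h. h \<in> F \<Longrightarrow> \<exists>a c. h = {y. a \<bullet> y \<le> c}"
    using assms(1) unfolding polyhedron_def by metis
  have "\<And>h. h \<in> F \<Longrightarrow> x \<in> h" using F(2) assms(2) by blast
  with F(1,3) have "\<exists>N. finite N \<and> feasible_directions x (\<Inter>F) = {d. \<forall>a\<in>N. a \<bullet> d \<le> 0}"
  proof (induction F rule: finite_induct)
    case empty
    have "feasible_directions x UNIV = UNIV"
      by (auto simp: feasible_directions_def intro: exI[of _ 1])
    then show ?case by (auto intro: exI[of _ "{}"])
  next
    case (insert h F)
    obtain a c where h: "h = {y. a \<bullet> y \<le> c}" using insert.prems(1) by blast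
    have "convex h" by (simp add: h convex_halfspace_le)
    moreover have "convex (\<Inter>F)"
      by (rule convex_Inter) (metis insert.prems(1) insertCI convex_halfspace_le)
    ultimately have Int: "feasible_directions x (\<Inter>(insert h F))
        = feasible_directions x h \<inter> feasible_directions x (\<Inter>F)"
      using insert.prems(2) by (simp add: feasible_directions_Int)
    have "\<exists>N. finite N \<and> feasible_directions x (\<Inter>F) = {d. \<forall>a\<in>N. a \<bullet> d \<le> 0}"
      by (rule insert.IH) (use insert.prems in auto)
    then obtain N where N: "finite N" "feasible_directions x (\<Inter>F) = {d. \<forall>a\<in>N. a \<bullet> d \<le> 0}"
      by blast
    have "a \<bullet> x \<le> c" using insert.prems(2)[of h] h by simp
    then have "feasible_directions x (\<Inter>(insert h F))
        = {d. \<forall>a\<in>(if a \<bullet> x = c then insert a N else N). a \<bullet> d \<le> 0}"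
      unfolding Int N(2) unfolding h by (auto simp: feasible_directions_halfspace)
    moreover have "finite (if a \<bullet> x = c then insert a N else N)" using N(1) by simp
    ultimately show ?case by blast
  qed
  then show ?thesis by (simp add: F(2))
qed

section \<open>Separation from a closed cone and positive weights\<close>

lemma separating_vector_convex_cone:
  fixes Q :: "'a::euclidean_space set"
  assumes "convex_cone Q" "closed Q" "z \<notin> Q"
  shows "\<exists>d. d \<bullet> z > 0 \<and> (\<forall>q\<in>Q. d \<bullet> q \<le> 0)"
proof -
  have "convex Q" "conic Q" "0 \<in> Q"
    using assms(1) by (auto simp: convex_cone_def convex_cone_contains_0)
  obtain w c where w: "w \<bullet> z < c" "\<forall>q\<in>Q. c < w \<bullet> q"
    using separating_hyperplane_closed_point[OF \<open>convex Q\<close> assms(2,3)] by blast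
  have "c < w \<bullet> 0" using w(2) \<open>0 \<in> Q\<close> by blast
  then have "c < 0" by simp
  have "0 \<le> w \<bullet> q" if q: "q \<in> Q" for q
  proof (rule ccontr)
    assume neg: "\<not> 0 \<le> w \<bullet> q"
    \<comment> \<open>Scaling \<open>q\<close> by this factor lands on the hyperplane where
      \<open>w\<close> takes the value \<open>c\<close>, which the strict separation keeps away from
      \<open>Q\<close>.\<close>
    then have "0 \<le> c / (w \<bullet> q)" using \<open>c < 0\<close> by (simp add: zero_le_divide_iff)
    then have "(c / (w \<bullet> q)) *\<^sub>R q \<in> Q" using \<open>conic Q\<close> q by (simp add: conic_def)
    with w(2) have "c < w \<bullet> ((c / (w \<bullet> q)) *\<^sub>R q)" by blast
    then show False using neg by simp
  qed
  then show ?thesis using w(1) \<open>c < 0\<close> by (intro exI[of _ "- w"]) auto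
qed

text \<open>Polyhedrality is what makes all weights positive: at the leftmost point of a disc in the
  plane, the only supporting weight has a zero entry.\<close>

lemma efficient_point_positive_weight:
  fixes f :: "'a::euclidean_space \<Rightarrow> real ^ 'p"
  assumes "linear f" "polyhedron X" "x \<in> X"
    and min: "\<And>z. z \<in> X \<Longrightarrow> f z \<le> f x \<Longrightarrow> f z = f x"
  shows "\<exists>w\<in>weights. \<forall>z\<in>X. w \<bullet> f x \<le> w \<bullet> f z"
proof -
  obtain N where N: "finite N" "feasible_directions x X = {d. \<forall>a\<in>N. a \<bullet> d \<le> 0}"
    using feasible_directions_polyhedron[OF assms(2,3)] by blast
  \<comment> \<open>\<open>r i\<close> is row \<open>i\<close> of the matrix of \<open>f\<close>, as
    a vector representing objective \<open>i\<close>.\<close>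
  define r where "r = (\<lambda>i. adjoint f (axis i 1))"
  have r: "r i \<bullet> d = f d $ i" for i d
    using adjoint_works[OF assms(1), of d "axis i 1"] by (simp add: r_def inner_axis inner_commute)
  define Q where "Q = convex_cone hull (N \<union> range r)"
  have Q: "convex_cone Q" "closed Q" "N \<subseteq> Q" "\<And>i. r i \<in> Q"
    using N(1) by (auto simp: Q_def convex_cone_convex_cone_hull closed_convex_cone_hull intro: hull_inc)
  have "- (\<Sum>i\<in>UNIV. r i) \<in> Q"
  proof (rule ccontr)
    assume "- (\<Sum>i\<in>UNIV. r i) \<notin> Q"
    \<comment> \<open>Testing \<open>d\<close> against \<open>N\<close> makes it a feasible
      direction, and testing it against the rows shows that no objective increases along it.
      Efficiency then forces \<open>f d = 0\<close>, whereas the separation makes the sum of the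
      entries of \<open>f d\<close> negative.\<close>
    then obtain d where d: "d \<bullet> (- (\<Sum>i\<in>UNIV. r i)) > 0" "\<forall>q\<in>Q. d \<bullet> q \<le> 0"
      using separating_vector_convex_cone[OF Q(1,2)] by blast
    have neg: "f d $ i \<le> 0" for i
      using d(2) Q(4)[of i] r[of i d] by (metis inner_commute)
    have "d \<in> feasible_directions x X"
      using d(2) Q(3) by (auto simp: N(2) inner_commute)
    then obtain t where t: "t > 0" "x + t *\<^sub>R d \<in> X"
      by (auto simp: feasible_directions_def)
    have ft: "f (x + t *\<^sub>R d) = f x + t *\<^sub>R f d"
      using assms(1) by (simp add: linear_add linear_scale)
    have "f (x + t *\<^sub>R d) \<le> f x"
      using neg t(1) by (simp add: ft less_eq_vec_def mult_nonneg_nonpos)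
    from min[OF t(2) this] t(1) have "f d = 0" by (simp add: ft)
    then have "r i \<bullet> d = 0" for i by (simp add: r)
    then show False using d(1) by (simp add: inner_sum_right inner_commute)
  qed
  \<comment> \<open>\<open>V\<close> avoids extracting coefficients from the hull: \<open>v\<close>
    stands for the coefficients of the rows, and the normals in \<open>N\<close> contribute at most
    0 on feasible directions. So \<open>v\<close> is 0 for a normal and a unit vector for a row, and
    these bounds add and scale.\<close>
  moreover define V where "V = {q. \<exists>v. 0 \<le> v \<and> (\<forall>d\<in>feasible_directions x X. q \<bullet> d \<le> v \<bullet> f d)}"
  have "Q \<subseteq> V"
    unfolding Q_def
  proof (rule hull_minimal)
    have "q \<in> V" if "q \<in> N" for q
      using that by (auto simp: V_def N(2) intro!: exI[of _ 0])
    moreover have "r i \<in> V" for i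
    proof -
      have "0 \<le> (axis i 1 :: real ^ 'p)" by (simp add: less_eq_vec_def axis_def)
      moreover have "r i \<bullet> d \<le> axis i 1 \<bullet> f d" for d by (simp add: r inner_axis')
      ultimately show ?thesis unfolding V_def by blast
    qed
    ultimately show "N \<union> range r \<subseteq> V" by blast
    have "p + q \<in> V" if pq: "p \<in> V" "q \<in> V" for p q
    proof -
      obtain u v where "0 \<le> u" "\<forall>d\<in>feasible_directions x X. p \<bullet> d \<le> u \<bullet> f d"
        "0 \<le> v" "\<forall>d\<in>feasible_directions x X. q \<bullet> d \<le> v \<bullet> f d"
        using pq unfolding V_def by blast
      then have "0 \<le> u + v \<and> (\<forall>d\<in>feasible_directions x X. (p + q) \<bullet> d \<le> (u + v) \<bullet> f d)"
        by (auto simp: inner_add_left less_eq_vec_def add_mono)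
      then show ?thesis unfolding V_def by blast
    qed
    moreover have "k *\<^sub>R q \<in> V" if k: "q \<in> V" "0 \<le> k" for q k
    proof -
      obtain v where "0 \<le> v" "\<forall>d\<in>feasible_directions x X. q \<bullet> d \<le> v \<bullet> f d"
        using k(1) unfolding V_def by blast
      then have "0 \<le> k *\<^sub>R v \<and> (\<forall>d\<in>feasible_directions x X. (k *\<^sub>R q) \<bullet> d \<le> (k *\<^sub>R v) \<bullet> f d)"
        using k(2) by (auto simp: less_eq_vec_def mult_left_mono)
      then show ?thesis unfolding V_def by blast
    qed
    moreover have "0 \<in> V" by (auto simp: V_def intro!: exI[of _ 0])
    ultimately show "convex_cone V" by (auto simp: convex_cone_iff)
  qed
  ultimately have "- (\<Sum>i\<in>UNIV. r i) \<in> V" by blast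
  then obtain v where v: "0 \<le> v"
    "\<And>d. d \<in> feasible_directions x X \<Longrightarrow> - (\<Sum>i\<in>UNIV. r i) \<bullet> d \<le> v \<bullet> f d"
    unfolding V_def by blast
  \<comment> \<open>Moving the sum of the rows to the right side of the bound adds the all-ones
    vector to \<open>v\<close>, so nonnegative entries become positive.\<close>
  define w where "w = 1 + v"
  have pos: "w $ i > 0" for i
  proof -
    have "0 \<le> v $ i" using v(1) by (simp add: less_eq_vec_def)
    then show ?thesis by (simp add: w_def)
  qed
  have nonneg: "0 \<le> w \<bullet> f d" if d: "d \<in> feasible_directions x X" for d
  proof -
    have "(\<Sum>i\<in>UNIV. r i) \<bullet> d = 1 \<bullet> f d"
      by (simp add: inner_sum_left r) (simp add: inner_vec_def)
    then show ?thesis using v(2)[OF d] by (simp add: w_def inner_add_left)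
  qed
  define s where "s = (\<Sum>i\<in>UNIV. w $ i)"
  have "s > 0" unfolding s_def by (rule sum_pos) (auto simp: pos)
  then have "(1 / s) *\<^sub>R w \<in> weights"
    using pos by (simp add: weights_def pos_orthant_def s_def flip: sum_divide_distrib)
  moreover have "((1 / s) *\<^sub>R w) \<bullet> f x \<le> ((1 / s) *\<^sub>R w) \<bullet> f z" if z: "z \<in> X" for z
  proof -
    \<comment> \<open>Every point of \<open>X\<close> is reached from \<open>x\<close> by a step of
      length 1, so the bound on directions gives global optimality.\<close>
    have "z - x \<in> feasible_directions x X"
      using z by (auto simp: feasible_directions_def intro: exI[of _ 1])
    from nonneg[OF this] have "w \<bullet> f x \<le> w \<bullet> f z"
      using assms(1) by (simp add: linear_diff inner_diff_right)
    then show ?thesis using \<open>s > 0\<close> by (simp add: divide_right_mono)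
  qed
  ultimately show ?thesis by blast
qed

section \<open>Feasible set and outcome set\<close>

lemma polyhedron_feasible_set: "polyhedron (feasible_set A b)"
proof -
  have "feasible_set A b = (\<Inter>i. {x. A $ i \<bullet> x \<le> b $ i}) \<inter> (\<Inter>j. {x. axis j 1 \<bullet> x \<ge> 0})"
    by (auto simp: feasible_set_def less_eq_vec_def matrix_vector_mul_component inner_axis')
  then show ?thesis
    by (auto intro!: polyhedron_Int polyhedron_Inter polyhedron_halfspace_le polyhedron_halfspace_ge)
qed

lemma convex_outcome_set: "convex (outcome_set A b C)"
proof -
  have "outcome_set A b C = (*v) C ` feasible_set A b"
    by (auto simp: outcome_set_def)
  then show ?thesis
    by (simp add: convex_linear_image polyhedron_imp_convex polyhedron_feasible_set)
qed

text \<open>Efficiency of \<open>x\<close> depends only on \<open>C *v x\<close>, so the arguments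
  about boundary and frontier can stay in the outcome space.\<close>

lemma nondominated_set_iff:
  "y \<in> nondominated_set A b C \<longleftrightarrow>
    y \<in> outcome_set A b C \<and> (\<forall>z\<in>outcome_set A b C. z \<le> y \<longrightarrow> z = y)"
  by (auto simp: nondominated_set_def outcome_set_def efficient_def)

section \<open>Each supported set is the whole non-dominated set\<close>

lemma supported_weighted_eq_nondominated: "supported_weighted A b C = nondominated_set A b C"
proof (intro equalityI subsetI)
  fix y assume y: "y \<in> nondominated_set A b C"
  then obtain x where x: "y = C *v x" "efficient A b C x"
    by (auto simp: nondominated_set_def)
  have "\<exists>w\<in>weights. \<forall>z\<in>feasible_set A b. w \<bullet> (C *v x) \<le> w \<bullet> (C *v z)"
    by (rule efficient_point_positive_weight)
      (use x(2) in \<open>auto simp: efficient_def polyhedron_feasible_set\<close>)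
  then obtain w where w: "w \<in> weights" "\<forall>z\<in>feasible_set A b. w \<bullet> (C *v x) \<le> w \<bullet> (C *v z)"
    by blast
  then have "weighted_sum_optimal A b C w x"
    using x(2) by (auto simp: weighted_sum_optimal_def is_arg_min_def efficient_def not_less)
  with w(1) x show "y \<in> supported_weighted A b C"
    by (auto simp: supported_weighted_def)
qed (auto simp: supported_weighted_def nondominated_set_def)

text \<open>The convex outcome set contains the hull, so a hull point below a non-dominated
  \<open>y\<close> is itself an outcome and cannot differ from \<open>y\<close>.\<close>

lemma supported_frontier_eq_nondominated: "supported_frontier A b C = nondominated_set A b C"
proof -
  have hull: "convex hull nondominated_set A b C \<subseteq> outcome_set A b C"
    by (rule hull_minimal)
      (auto simp: nondominated_set_iff convex_outcome_set)
  have "y \<in> nondominated_frontier A b C" if y: "y \<in> nondominated_set A b C" for y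
  proof -
    have "y \<in> convex hull nondominated_set A b C" using y by (rule hull_inc)
    moreover have "y \<in> (\<lambda>r. y - r) ` nonneg_orthant"
      by (rule image_eqI[of _ _ 0]) (auto simp: nonneg_orthant_def)
    moreover have "z = y" if "z \<in> convex hull nondominated_set A b C"
      "z \<in> (\<lambda>r. y - r) ` nonneg_orthant" for z
    proof -
      have "z \<le> y" using that(2) by (auto simp: nonneg_orthant_def less_eq_vec_def)
      then show ?thesis using y that(1) hull by (auto simp: nondominated_set_iff)
    qed
    ultimately show ?thesis by (auto simp: nondominated_frontier_def)
  qed
  then show ?thesis by (auto simp: supported_frontier_def)
qed

text \<open>If \<open>y\<close> were interior, it could be lowered in one coordinate and still lie
  above some outcome, which would then dominate \<open>y\<close>.\<close>

lemma supported_boundary_eq_nondominated: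
  fixes C :: "real ^ 'n ^ 'p"
  shows "supported_boundary A b C = nondominated_set A b C"
proof -
  have "convex (nonneg_orthant :: (real ^ 'p) set)"
    by (auto intro!: convexI simp: nonneg_orthant_def less_eq_vec_def)
  with convex_outcome_set have "convex (outcome_set A b C + nonneg_orthant)"
    by (rule convex_set_plus)
  then have hull: "upper_image A b C \<subseteq> outcome_set A b C + nonneg_orthant"
    unfolding upper_image_def
    by (intro hull_minimal set_plus_mono2) (auto simp: nondominated_set_iff)
  have "y \<in> frontier (upper_image A b C)" if y: "y \<in> nondominated_set A b C" for y
  proof -
    have "y + 0 \<in> nondominated_set A b C + nonneg_orthant"
      using y by (intro set_plus_intro) (auto simp: nonneg_orthant_def)
    then have "y \<in> upper_image A b C"
      unfolding upper_image_def by (simp add: hull_inc)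
    moreover have "y \<notin> interior (upper_image A b C)"
    proof
      assume "y \<in> interior (upper_image A b C)"
      then obtain e where e: "e > 0" "cball y e \<subseteq> upper_image A b C"
        by (auto simp: mem_interior_cball)
      fix i :: 'p
      have "y - e *\<^sub>R axis i 1 \<in> cball y e" using e(1) by (simp add: dist_norm)
      then have "y - e *\<^sub>R axis i 1 \<in> outcome_set A b C + nonneg_orthant"
        using e(2) hull by blast
      then obtain z r where z: "z \<in> outcome_set A b C" "0 \<le> r" "y - e *\<^sub>R axis i 1 = z + r"
        unfolding set_plus_def nonneg_orthant_def by blast
      have zr: "y $ k - e * (axis i 1 :: real ^ 'p) $ k = z $ k + r $ k" for k
        using arg_cong[OF z(3), of "\<lambda>v. v $ k"]
        by (simp only: vector_minus_component vector_add_component vector_scaleR_component real_scaleR_def)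
      have rk: "0 \<le> r $ k" for k using z(2) by (simp add: less_eq_vec_def)
      have "z \<le> y"
        unfolding less_eq_vec_def
      proof
        fix k
        have "e * (axis i 1 :: real ^ 'p) $ k \<ge> 0" using e(1) by (simp add: axis_def)
        then show "z $ k \<le> y $ k" using zr[of k] rk[of k] by linarith
      qed
      with y z(1) have "z = y" by (auto simp: nondominated_set_iff)
      \<comment> \<open>With \<open>z = y\<close>, coordinate \<open>i\<close> reads
        \<open>- e = r $ i\<close>, although \<open>r\<close> is nonnegative.\<close>
      with zr[of i] rk[of i] e(1) show False by simp
    qed
    ultimately show ?thesis
      using closure_subset by (auto simp: frontier_def)
  qed
  then show ?thesis by (auto simp: supported_boundary_def)
qed

theorem theorem2p2:
  fixes A :: "real ^ 'n ^ 'm" and b :: "real ^ 'm" and C :: "real ^ 'n ^ 'p"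
  assumes "CARD('p) \<ge> 2"
    and "nondominated_set A b C \<noteq> {}"
  shows "supported_boundary A b C = supported_frontier A b C
       \<and> supported_frontier A b C = supported_weighted A b C"
  by (simp add: supported_boundary_eq_nondominated supported_frontier_eq_nondominated
      supported_weighted_eq_nondominated)

end
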